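(* Let $1\leq p\leq \infty$, $\alpha>0$, and let $\mu$ be a positive Borel measure on $(0,\infty)$ such that $\mu((0,1))=0$ and $$\sup_{n\in\mathbb{N}}\int_{1}^{\infty}\frac{1}{t^{n+1}}\,d\mu(t)<\infty.$$ Then the Hausdorff operator $\mathcal{H}_{\mu}$ is bounded on $F^{p}_{\alpha}$, and $$\|\mathcal{H}_{\mu}\|_{F^{p}_{\alpha}\to F^{p}_{\alpha}}=\sup\left\{\int_{1}^{\infty}\frac{1}{t^{n+1}}\,d\mu(t)\,:\, n\in\mathbb{N}\right\}.$$
   Context: $\mathbb{N}=\{0,1,2,\dots\}$. For $1\le p<\infty$ and $\alpha>0$, the Fock space $F^p_\alpha$ is the space of entire functions $f$ with $\|f\|_{p,\alpha}^p=\frac{\alpha p}{2\pi}\int_{\mathbb{C}}|f(z)e^{-\frac{\alpha}{2}|z|^2}|^p\,dA(z)<\infty$, where $dA$ is Lebesgue area measure; $F^\infty_\alpha$ is the space of entire functions $f$ with $\|f\|_{\infty,\alpha}=\sup_{z\in\mathbb{C}}|f(z)|e^{-\frac{\alpha}{2}|z|^2}<\infty$. For a positive Borel measure $\mu$ on $(0,\infty)$, the Hausdorff operator is $\mathcal{H}_{\mu}(f)(z)=\int_{0}^{\infty}\frac{1}{t}f\left(\frac{z}{t}\right)d\mu(t)$, $z\in\mathbb{C}$ (under the stated hypotheses on $\mu$ this integral converges for every $f\in F^p_\alpha$). *)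

theory Defs
  imports "HOL-Analysis.Analysis"
begin

definition fock_weight :: "real \<Rightarrow> (complex \<Rightarrow> complex) \<Rightarrow> complex \<Rightarrow> real" where
  "fock_weight \<alpha> f z = norm (f z) * exp (- (\<alpha> / 2) * (norm z)\<^sup>2)"

definition in_fock :: "ennreal \<Rightarrow> real \<Rightarrow> (complex \<Rightarrow> complex) \<Rightarrow> bool" where
  "in_fock p \<alpha> f \<longleftrightarrow> f holomorphic_on UNIV \<and>
     (if p = \<infinity> then bounded (range (fock_weight \<alpha> f))
      else (\<integral>\<^sup>+ z. ennreal (fock_weight \<alpha> f z powr enn2real p) \<partial>lborel) < \<infinity>)"

text \<open>The Fock norm (meaningful for members of F^p_alpha).\<close>
definition fock_norm :: "ennreal \<Rightarrow> real \<Rightarrow> (complex \<Rightarrow> complex) \<Rightarrow> real" where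
  "fock_norm p \<alpha> f =
     (if p = \<infinity> then (SUP z. fock_weight \<alpha> f z)
      else (\<alpha> * enn2real p / (2 * pi) *
              (\<integral> z. fock_weight \<alpha> f z powr enn2real p \<partial>lborel)) powr (1 / enn2real p))"

text \<open>Hausdorff operator; mu is a measure on the reals concentrated on (0,\<infinity>).\<close>
definition hausdorff_op :: "real measure \<Rightarrow> (complex \<Rightarrow> complex) \<Rightarrow> complex \<Rightarrow> complex" where
  "hausdorff_op \<mu> f z = (\<integral> t. complex_of_real (1 / t) * f (z / complex_of_real t) \<partial>\<mu>)"

definition fock_opnorm :: "ennreal \<Rightarrow> real \<Rightarrow> ((complex \<Rightarrow> complex) \<Rightarrow> (complex \<Rightarrow> complex)) \<Rightarrow> real" where
  "fock_opnorm p \<alpha> T =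
     Sup {fock_norm p \<alpha> (T f) / fock_norm p \<alpha> f | f. in_fock p \<alpha> f \<and> fock_norm p \<alpha> f \<noteq> 0}"

end

theory Submission
  imports Defs "HOL-Complex_Analysis.Complex_Analysis" "HOL-Probability.Probability"
begin

text \<open>
  For \<open>t \<ge> 1\<close> the integrals decrease in \<open>n\<close>, so the supremum is the total mass
  \<open>M = \<integral> 1/t d\<mu>\<close>, and the constant function \<open>1\<close> is mapped to \<open>M\<close>. For the upper bound, Poisson's
  formula writes the dilation \<open>f (r z)\<close> with \<open>r < 1\<close> as an average of the rotations \<open>f (e\<^sup>i\<^sup>\<theta> z)\<close>, so
  Jensen's inequality, Tonelli's theorem and the rotation invariance of area measure show that
  dilations are contractions of the Fock space. A second application of Jensen and Tonelli, to the
  probability measure \<open>1 / (M t) d\<mu>(t)\<close>, bounds the Hausdorff operator by \<open>M\<close>. It preserves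
  entire functions because it multiplies the \<open>n\<close>-th Taylor coefficient by \<open>\<integral> 1/t\<^sup>n\<^sup>+\<^sup>1 d\<mu>\<close>.
\<close>

subsection \<open>Rotation invariance of area measure\<close>

text \<open>Lebesgue measure is determined by its values on boxes, and a box in the plane is the
  product of the intervals of real and imaginary parts. This opens area integrals to Tonelli's
  theorem in coordinates.\<close>

lemma lborel_complex_eq_distr:
  "lborel = distr (lborel \<Otimes>\<^sub>M lborel) borel (\<lambda>(x, y). Complex x y)"
proof (rule lborel_eqI)
  fix l u :: complex
  assume le: "\<And>b. b \<in> Basis \<Longrightarrow> l \<bullet> b \<le> u \<bullet> b"
  have [measurable]: "(\<lambda>(x, y). Complex x y) \<in> borel_measurable (lborel \<Otimes>\<^sub>M lborel)"
    unfolding borel_measurable_complex_iff by (auto simp: case_prod_beta)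
  have lu: "Re l \<le> Re u" "Im l \<le> Im u"
    using le[of 1] le[of \<i>] by (auto simp: Basis_complex_def inner_complex_def)
  have "(\<lambda>(x, y). Complex x y) -` box l u \<inter> space (lborel \<Otimes>\<^sub>M lborel)
      = {Re l <..< Re u} \<times> {Im l <..< Im u}"
    by (auto simp: box_def Basis_complex_def inner_complex_def space_pair_measure)
  then show "emeasure (distr (lborel \<Otimes>\<^sub>M lborel) borel (\<lambda>(x, y). Complex x y)) (box l u)
      = ennreal (\<Prod>b\<in>Basis. (u - l) \<bullet> b)"
    using lu by (simp add: emeasure_distr lborel.emeasure_pair_measure_Times Basis_complex_def
        inner_complex_def ennreal_mult)
qed simp

text \<open>Both orders of integration are recorded: a horizontal shear is undone in an inner
  integral over \<open>x\<close>, a vertical one in an inner integral over \<open>y\<close>.\<close>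

lemma nn_integral_lborel_complex:
  fixes F :: "complex \<Rightarrow> ennreal"
  assumes [measurable]: "F \<in> borel_measurable borel"
  shows "(\<integral>\<^sup>+ z. F z \<partial>lborel) = (\<integral>\<^sup>+ y. \<integral>\<^sup>+ x. F (Complex x y) \<partial>lborel \<partial>lborel)"
    and "(\<integral>\<^sup>+ z. F z \<partial>lborel) = (\<integral>\<^sup>+ x. \<integral>\<^sup>+ y. F (Complex x y) \<partial>lborel \<partial>lborel)"
proof -
  have [measurable]: "(\<lambda>(x, y). Complex x y) \<in> borel_measurable (lborel \<Otimes>\<^sub>M lborel)"
    unfolding borel_measurable_complex_iff by (auto simp: case_prod_beta)
  have m: "(\<lambda>(x, y). F (Complex x y)) \<in> borel_measurable (lborel \<Otimes>\<^sub>M lborel)"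
    using measurable_compose[OF \<open>(\<lambda>(x, y). Complex x y) \<in> _\<close> assms]
    by (simp add: case_prod_beta)
  have eq: "(\<integral>\<^sup>+ z. F z \<partial>lborel) = (\<integral>\<^sup>+ xy. (\<lambda>(x, y). F (Complex x y)) xy \<partial>(lborel \<Otimes>\<^sub>M lborel))"
    by (subst lborel_complex_eq_distr, subst nn_integral_distr) (auto simp: case_prod_unfold)
  show "(\<integral>\<^sup>+ z. F z \<partial>lborel) = (\<integral>\<^sup>+ x. \<integral>\<^sup>+ y. F (Complex x y) \<partial>lborel \<partial>lborel)"
    unfolding eq using lborel.nn_integral_fst[OF m] by simp
  show "(\<integral>\<^sup>+ z. F z \<partial>lborel) = (\<integral>\<^sup>+ y. \<integral>\<^sup>+ x. F (Complex x y) \<partial>lborel \<partial>lborel)"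
    unfolding eq using lborel_pair.nn_integral_snd[OF m] by simp
qed

text \<open>With the other coordinate fixed, a shear is a translation of the line, so the inner
  integral is unchanged.\<close>

lemma nn_integral_complex_shear:
  fixes F :: "complex \<Rightarrow> ennreal"
  assumes [measurable]: "F \<in> borel_measurable borel"
  shows "(\<integral>\<^sup>+ z. F (Complex (Re z + k * Im z) (Im z)) \<partial>lborel) = (\<integral>\<^sup>+ z. F z \<partial>lborel)"
    and "(\<integral>\<^sup>+ z. F (Complex (Re z) (Im z + k * Re z)) \<partial>lborel) = (\<integral>\<^sup>+ z. F z \<partial>lborel)"
proof -
  have [measurable]: "(\<lambda>z. Complex (Re z + k * Im z) (Im z)) \<in> borel_measurable borel"
    "(\<lambda>z. Complex (Re z) (Im z + k * Re z)) \<in> borel_measurable borel"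
    "\<And>y. (\<lambda>x. Complex x y) \<in> borel_measurable borel"
    "\<And>x. (\<lambda>y. Complex x y) \<in> borel_measurable borel"
    unfolding borel_measurable_complex_iff by auto
  have "(\<integral>\<^sup>+ x. F (Complex (x + k * y) y) \<partial>lborel) = (\<integral>\<^sup>+ x. F (Complex x y) \<partial>lborel)" for y
    using nn_integral_real_affine[of "\<lambda>x. F (Complex x y)" 1 "k * y"] by (simp add: add.commute)
  then show "(\<integral>\<^sup>+ z. F (Complex (Re z + k * Im z) (Im z)) \<partial>lborel) = (\<integral>\<^sup>+ z. F z \<partial>lborel)"
    by (simp add: nn_integral_lborel_complex(1))
  have "(\<integral>\<^sup>+ y. F (Complex x (y + k * x)) \<partial>lborel) = (\<integral>\<^sup>+ y. F (Complex x y) \<partial>lborel)" for x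
    using nn_integral_real_affine[of "\<lambda>y. F (Complex x y)" 1 "k * x"] by (simp add: add.commute)
  then show "(\<integral>\<^sup>+ z. F (Complex (Re z) (Im z + k * Re z)) \<partial>lborel) = (\<integral>\<^sup>+ z. F z \<partial>lborel)"
    by (simp add: nn_integral_lborel_complex(2))
qed

text \<open>A rotation other than \<open>-1\<close> is a product of three shears with slopes
  \<open>- tan (\<theta> / 2)\<close>, \<open>sin \<theta>\<close>, \<open>- tan (\<theta> / 2)\<close>.\<close>

lemma nn_integral_complex_rotation:
  fixes F :: "complex \<Rightarrow> ennreal"
  assumes F: "F \<in> borel_measurable borel" and u: "norm u = 1"
  shows "(\<integral>\<^sup>+ z. F (u * z) \<partial>lborel) = (\<integral>\<^sup>+ z. F z \<partial>lborel)"
proof -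
  have main: "(\<integral>\<^sup>+ z. G (v * z) \<partial>lborel) = (\<integral>\<^sup>+ z. G z \<partial>lborel)"
    if G[measurable]: "G \<in> borel_measurable borel" and v: "norm v = 1" "v \<noteq> -1"
    for v and G :: "complex \<Rightarrow> ennreal"
  proof -
    have sq: "(Re v)\<^sup>2 + (Im v)\<^sup>2 = 1"
      using v(1) by (simp add: cmod_def)
    \<comment> \<open>On the unit circle a real part of -1 forces the imaginary part to vanish,
      which is the excluded point.\<close>
    have c: "1 + Re v \<noteq> 0"
    proof
      assume "1 + Re v = 0"
      then have "Re v = -1" by simp
      with sq v(2) show False by (simp add: complex_eq_iff)
    qed
    \<comment> \<open>For \<open>v\<close> of argument \<open>\<theta>\<close> this is
      \<open>- tan (\<theta> / 2)\<close>, by the half-angle formula.\<close>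
    define k where "k = - Im v / (1 + Re v)"
    have kc: "k * (1 + Re v) = - Im v"
      using c by (simp add: k_def)
    \<comment> \<open>Multiplying by \<open>1 + Re v\<close> clears the denominator of
      \<open>k\<close>; what remains is the equation of the unit circle.\<close>
    have "(1 + k * Im v - Re v) * (1 + Re v) = 0"
      using kc sq by (simp add: algebra_simps power2_eq_square) algebra
    then have ks: "k * Im v = Re v - 1"
      using c by simp
    define A where "A = (\<lambda>z. Complex (Re z + k * Im z) (Im z))"
    define B where "B = (\<lambda>z. Complex (Re z) (Im z + Im v * Re z))"
    have [measurable]: "A \<in> borel_measurable borel" "B \<in> borel_measurable borel"
      unfolding A_def B_def borel_measurable_complex_iff by auto
    have shear_A: "(\<integral>\<^sup>+ z. F (A z) \<partial>lborel) = (\<integral>\<^sup>+ z. F z \<partial>lborel)"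
      and shear_B: "(\<integral>\<^sup>+ z. F (B z) \<partial>lborel) = (\<integral>\<^sup>+ z. F z \<partial>lborel)"
      if "F \<in> borel_measurable borel" for F
      unfolding A_def B_def using nn_integral_complex_shear[OF that] by auto
    have "v * z = A (B (A z))" for z
    proof -
      have "Re (A (B (A z))) = Re z * (1 + k * Im v) + Im z * (k * (2 + k * Im v))"
        by (simp add: A_def B_def algebra_simps)
      also have "\<dots> = Re v * Re z - Im v * Im z"
        using kc by (simp add: ks algebra_simps)
      finally have 1: "Re (A (B (A z))) = Re (v * z)" by simp
      have "Im (A (B (A z))) = Im z * (1 + k * Im v) + Im v * Re z"
        by (simp add: A_def B_def algebra_simps)
      then have 2: "Im (A (B (A z))) = Im (v * z)"
        by (simp add: ks)
      from 1 2 show ?thesis by (simp add: complex_eq_iff)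
    qed
    \<comment> \<open>The shears are removed one at a time, starting with the one applied directly
      to \<open>z\<close>.\<close>
    then have "(\<integral>\<^sup>+ z. G (v * z) \<partial>lborel) = (\<integral>\<^sup>+ z. (\<lambda>w. G (A (B w))) (A z) \<partial>lborel)"
      by simp
    also have "\<dots> = (\<integral>\<^sup>+ z. (\<lambda>w. G (A w)) (B z) \<partial>lborel)"
      by (rule shear_A[where F = "\<lambda>w. G (A (B w))"]) measurable
    also have "\<dots> = (\<integral>\<^sup>+ z. G (A z) \<partial>lborel)"
      by (rule shear_B[where F = "\<lambda>w. G (A w)"]) measurable
    also have "\<dots> = (\<integral>\<^sup>+ z. G z \<partial>lborel)"
      by (rule shear_A) measurable
    finally show ?thesis .
  qed
  show ?thesis
  proof (cases "u = -1")
    case True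
    \<comment> \<open>The rotation by -1 is the quarter turn \<open>\<i>\<close> applied twice, and
      \<open>\<i>\<close> is covered by \<open>main\<close>.\<close>
    have m: "(\<lambda>z. F (\<i> * z)) \<in> borel_measurable borel"
      using F by measurable
    have ne: "\<i> \<noteq> -1" by (simp add: complex_eq_iff)
    have "(\<integral>\<^sup>+ z. F (u * z) \<partial>lborel) = (\<integral>\<^sup>+ z. (\<lambda>w. F (\<i> * w)) (\<i> * z) \<partial>lborel)"
      by (simp add: True flip: mult.assoc)
    also have "\<dots> = (\<integral>\<^sup>+ z. F (\<i> * z) \<partial>lborel)"
      by (rule main[OF m _ ne]) simp
    also have "\<dots> = (\<integral>\<^sup>+ z. F z \<partial>lborel)"
      by (rule main[OF F _ ne]) simp
    finally show ?thesis .
  qed (use main[OF F u] in auto)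
qed

subsection \<open>Averages in Fock spaces\<close>

text \<open>A convex function lies above its tangent at \<open>m\<close>. Convexity is used on the
  open half-line, so the endpoint \<open>x = 0\<close> is computed directly: there the left side is
  \<open>(1 - q) * m powr q\<close>.\<close>

lemma powr_ge_tangent:
  fixes q m x :: real
  assumes "1 \<le> q" "0 < m" "0 \<le> x"
  shows "m powr q + q * m powr (q - 1) * (x - m) \<le> x powr q"
proof (cases "x = 0")
  case True
  have "m powr (q - 1) * m = m powr q"
    using assms powr_add[of m "q - 1" 1] by simp
  then have "m powr q + q * m powr (q - 1) * (x - m) = (1 - q) * m powr q"
    by (simp add: True algebra_simps)
  also have "\<dots> \<le> 0"
    using assms by (simp add: mult_nonpos_nonneg)
  finally show ?thesis by (simp add: True)
next
  case False
  have "x powr q - m powr q \<ge> q * m powr (q - 1) * (x - m)"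
  proof (rule convex_on_imp_above_tangent[of "{0<..}" "\<lambda>x. x powr q"])
    show "((\<lambda>x. x powr q) has_real_derivative q * m powr (q - 1)) (at m within {0<..})"
      using has_real_derivative_powr[of m q] assms
      by (auto intro: has_field_derivative_at_within)
  qed (use assms False powr_convex in \<open>auto simp: interior_open\<close>)
  then show ?thesis by simp
qed

text \<open>Jensen's inequality, obtained by integrating the tangent inequality at the mean, where
  the linear term integrates to zero. A zero mean is trivial because
  \<open>0 powr q = 0\<close>.\<close>

lemma (in prob_space) expectation_powr_le:
  fixes X :: "'a \<Rightarrow> real"
  assumes "integrable M X" "integrable M (\<lambda>x. X x powr q)" "\<And>x. 0 \<le> X x" "1 \<le> q"
  shows "expectation X powr q \<le> expectation (\<lambda>x. X x powr q)"
proof (cases "expectation X = 0")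
  case False
  define m where "m = expectation X"
  have m: "0 < m"
    using False Bochner_Integration.integral_nonneg[of M X] assms(3) unfolding m_def by (simp add: less_le)
  have "m powr q = expectation (\<lambda>x. m powr q + q * m powr (q - 1) * (X x - m))"
    using assms by (simp add: prob_space flip: m_def)
  also have "\<dots> \<le> expectation (\<lambda>x. X x powr q)"
    using assms powr_ge_tangent[OF \<open>1 \<le> q\<close> m] by (intro integral_mono) auto
  finally show ?thesis by (simp add: m_def)
qed simp

lemma fock_weight_nonneg: "0 \<le> fock_weight \<alpha> f z"
  by (simp add: fock_weight_def)

lemma fock_weight_powr:
  "fock_weight \<alpha> f z powr q = norm (f z) powr q * exp (- (\<alpha> / 2) * (norm z)\<^sup>2) powr q"
  by (simp add: fock_weight_def powr_mult)

lemma continuous_bounded_on_disc: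
  fixes f :: "complex \<Rightarrow> complex"
  assumes "continuous_on UNIV f"
  obtains B where "\<And>w. norm w \<le> R \<Longrightarrow> norm (f w) \<le> B"
proof -
  have "compact (f ` cball 0 R)"
    using assms by (intro compact_continuous_image) (auto intro: continuous_on_subset)
  then obtain B where "\<forall>y\<in>f ` cball 0 R. norm y \<le> B"
    using compact_imp_bounded bounded_iff by metis
  then show ?thesis by (intro that[of B]) auto
qed

text \<open>The common core of both upper bounds: \<open>\<phi>\<close> is a point of the unit
  circle for Poisson averages and \<open>1 / t\<close> for the Hausdorff operator. Jensen's
  inequality is applied for each \<open>z\<close>, then Tonelli's theorem exchanges the
  integrals.\<close>

lemma nn_integral_fock_average_le:
  fixes f :: "complex \<Rightarrow> complex" and \<phi> :: "'a \<Rightarrow> complex"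
  assumes N: "prob_space N" and phi[measurable]: "\<phi> \<in> borel_measurable N"
    and disc: "AE s in N. norm (\<phi> s) \<le> 1"
    and f: "continuous_on UNIV f" and q: "1 \<le> q"
    and le: "AE s in N. (\<integral>\<^sup>+ z. ennreal (fock_weight \<alpha> (\<lambda>z. f (\<phi> s * z)) z powr q) \<partial>lborel) \<le> I"
  shows "(\<integral>\<^sup>+ z. ennreal (fock_weight \<alpha> (\<lambda>z. \<integral>s. f (\<phi> s * z) \<partial>N) z powr q) \<partial>lborel) \<le> I"
proof -
  interpret prob_space N by fact
  interpret pair_sigma_finite N "lborel :: complex measure" ..
  have [measurable]: "f \<in> borel_measurable borel"
    using f by (rule borel_measurable_continuous_onI)
  define K where "K s z = fock_weight \<alpha> (\<lambda>z. f (\<phi> s * z)) z powr q" for s z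
  have K[measurable]: "(\<lambda>(s, z). ennreal (K s z)) \<in> borel_measurable (N \<Otimes>\<^sub>M lborel)"
    unfolding K_def fock_weight_def by measurable
  have pw: "ennreal (fock_weight \<alpha> (\<lambda>z. \<integral>s. f (\<phi> s * z) \<partial>N) z powr q) \<le> (\<integral>\<^sup>+ s. ennreal (K s z) \<partial>N)" for z
  proof -
    define X where "X s = norm (f (\<phi> s * z))" for s
    have [measurable]: "X \<in> borel_measurable N"
      unfolding X_def by measurable
    \<comment> \<open>Almost every point \<open>\<phi> s * z\<close> lies in the closed disc of
      radius \<open>norm z\<close>, where \<open>f\<close> is bounded; on a probability space this
      makes \<open>X\<close> and its power integrable.\<close>
    obtain B where B: "\<And>w. norm w \<le> norm z \<Longrightarrow> norm (f w) \<le> B"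
      using continuous_bounded_on_disc[OF f] by blast
    have XB: "AE s in N. X s \<le> B"
      using disc by eventually_elim (auto simp: X_def norm_mult intro!: B mult_left_le_one_le)
    have X: "integrable N X"
      using XB by (intro integrable_const_bound[of _ B]) (auto simp: X_def)
    have Xq: "integrable N (\<lambda>s. X s powr q)"
    proof (rule integrable_const_bound)
      show "AE s in N. norm (X s powr q) \<le> B powr q"
        using XB by eventually_elim (use q in \<open>auto simp: X_def intro!: powr_mono2\<close>)
    qed measurable
    \<comment> \<open>The Gaussian factor does not depend on \<open>s\<close>, so it passes through
      the average.\<close>
    let ?e = "exp (- (\<alpha> / 2) * (norm z)\<^sup>2) powr q"
    have "fock_weight \<alpha> (\<lambda>z. \<integral>s. f (\<phi> s * z) \<partial>N) z powr q = norm (\<integral>s. f (\<phi> s * z) \<partial>N) powr q * ?e"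
      by (rule fock_weight_powr)
    also have "\<dots> \<le> expectation X powr q * ?e"
      unfolding X_def using q by (intro mult_right_mono powr_mono2 integral_norm_bound) auto
    also have "\<dots> \<le> expectation (\<lambda>s. X s powr q) * ?e"
      using X Xq q by (intro mult_right_mono expectation_powr_le) (auto simp: X_def)
    also have "\<dots> = expectation (\<lambda>s. K s z)"
      by (simp add: K_def fock_weight_powr X_def)
    finally have 1: "fock_weight \<alpha> (\<lambda>z. \<integral>s. f (\<phi> s * z) \<partial>N) z powr q \<le> expectation (\<lambda>s. K s z)" .
    have "integrable N (\<lambda>s. K s z)"
      using Xq by (simp add: K_def fock_weight_powr X_def)
    then have "(\<integral>\<^sup>+ s. ennreal (K s z) \<partial>N) = ennreal (expectation (\<lambda>s. K s z))"
      by (intro nn_integral_eq_integral) (auto simp: K_def)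
    with 1 show ?thesis by (simp add: ennreal_leI)
  qed
  have "(\<integral>\<^sup>+ z. ennreal (fock_weight \<alpha> (\<lambda>z. \<integral>s. f (\<phi> s * z) \<partial>N) z powr q) \<partial>lborel)
      \<le> (\<integral>\<^sup>+ z. \<integral>\<^sup>+ s. ennreal (K s z) \<partial>N \<partial>lborel)"
    by (intro nn_integral_mono pw)
  also have "\<dots> = (\<integral>\<^sup>+ s. \<integral>\<^sup>+ z. ennreal (K s z) \<partial>lborel \<partial>N)"
    by (rule Fubini') measurable
  also have "\<dots> \<le> (\<integral>\<^sup>+ s. I \<partial>N)"
    using le by (intro nn_integral_mono_AE) (simp add: K_def)
  also have "\<dots> = I"
    by (simp add: emeasure_space_1)
  finally show ?thesis .
qed

subsection \<open>Dilations as averages of rotations\<close>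

text \<open>The Poisson kernel of the unit disc at the real point \<open>r\<close>. The angle is
  \<open>2 * pi * s\<close> with \<open>s\<close> in the unit interval, as in
  \<open>circlepath\<close>, so no factor \<open>1 / (2 * pi)\<close> appears.\<close>

definition poisson_kernel :: "real \<Rightarrow> real \<Rightarrow> real" where
  "poisson_kernel r s = (1 - r\<^sup>2) / (norm (exp (2 * pi * \<i> * s) - of_real r))\<^sup>2"

text \<open>Cauchy's formula at \<open>r\<close> for \<open>g w (1 - r\<^sup>2) / (1 - r w)\<close>, which agrees with \<open>g\<close> at \<open>r\<close>
  and turns the Cauchy kernel into the Poisson kernel on the unit circle.\<close>

lemma poisson_formula:
  assumes g: "g holomorphic_on UNIV" and r: "0 \<le> r" "r < 1"
  shows "((\<lambda>s. poisson_kernel r s *\<^sub>R g (exp (2 * pi * \<i> * s))) has_integral g (of_real r)) {0..1}"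
proof -
  define h where "h w = g w * (1 - (of_real r)\<^sup>2) / (1 - of_real r * w)" for w :: complex
  \<comment> \<open>The denominator can vanish only at \<open>1 / r\<close>, outside the closed
    disc, so \<open>h\<close> is holomorphic there.\<close>
  have nz: "1 - of_real r * w \<noteq> 0" if "norm w \<le> 1" for w :: complex
  proof
    assume "1 - of_real r * w = 0"
    then have "norm (of_real r * w) = 1" by simp
    moreover have "norm (of_real r * w) \<le> r * 1"
      unfolding norm_mult using that r by (intro mult_mono) auto
    ultimately show False using r by simp
  qed
  have "h holomorphic_on cball 0 1"
    unfolding h_def using nz
    by (intro holomorphic_intros holomorphic_on_subset[OF g]) auto
  then have "((\<lambda>u. h u / (u - of_real r)) has_contour_integral 2 * of_real pi * \<i> * h (of_real r)) (circlepath 0 1)"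
    using r by (intro Cauchy_integral_circlepath)
      (auto intro: holomorphic_on_imp_continuous_on holomorphic_on_subset)
  then have I: "((\<lambda>s. h (circlepath 0 1 s) / (circlepath 0 1 s - of_real r)
        * vector_derivative (circlepath 0 1) (at s within {0..1}))
      has_integral 2 * of_real pi * \<i> * h (of_real r)) {0..1}"
    by (simp add: has_contour_integral_def)
  have "1 - (complex_of_real r)\<^sup>2 \<noteq> 0"
    using nz[of "of_real r"] r by (simp add: power2_eq_square)
  then have hr: "h (of_real r) = g (of_real r)"
    by (simp add: h_def power2_eq_square)
  have J: "((\<lambda>s. 1 / (2 * of_real pi * \<i>) * (h (circlepath 0 1 s) / (circlepath 0 1 s - of_real r)
        * vector_derivative (circlepath 0 1) (at s within {0..1})))
      has_integral g (of_real r)) {0..1}"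
    using has_integral_mult_right[OF I, of "1 / (2 * of_real pi * \<i>)"] by (simp add: hr)
  show ?thesis
  proof (rule has_integral_eq[OF _ J])
    fix s :: real
    assume s: "s \<in> {0..1}"
    define w where "w = exp (2 * pi * \<i> * s)"
    have nw: "norm w = 1"
      by (simp add: w_def)
    then have ww: "w * cnj w = 1"
      by (simp add: complex_norm_square[symmetric])
    have w0: "w \<noteq> 0" using nw by auto
    have wr: "w - of_real r \<noteq> 0" using nw r by auto
    have dn: "complex_of_real ((norm (w - of_real r))\<^sup>2) = (w - of_real r) * (cnj w - of_real r)"
      by (simp only: complex_norm_square) simp
    \<comment> \<open>On the circle 1 is \<open>w * cnj w\<close>. The factor \<open>w\<close>
      cancels against the one from the derivative of the path, and the two remaining denominators
      are conjugate, with product the squared distance from \<open>w\<close> to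
      \<open>r\<close>.\<close>
    have "1 - of_real r * w = w * (cnj w - of_real r)"
      using ww by (simp add: algebra_simps)
    moreover have "a / (w * c) / d * w = a / (d * c)" for a c d
      using w0 by (cases "c = 0"; cases "d = 0") (auto simp: field_simps)
    ultimately have "h w / (w - of_real r) * w = g w * (1 - (of_real r)\<^sup>2) / ((w - of_real r) * (cnj w - of_real r))"
      by (simp add: h_def)
    also have "\<dots> = poisson_kernel r s *\<^sub>R g w"
      unfolding poisson_kernel_def w_def[symmetric] scaleR_conv_of_real of_real_divide dn by simp
    finally have "h w / (w - of_real r) * w = poisson_kernel r s *\<^sub>R g w" .
    moreover have "circlepath 0 1 s = w"
      by (simp add: circlepath w_def)
    moreover have "vector_derivative (circlepath 0 1) (at s within {0..1}) = 2 * of_real pi * \<i> * w"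
      using s vector_derivative_circlepath01[of s 0 1] by (simp add: w_def)
    moreover have "1 / (2 * of_real pi * \<i>) * (x * (2 * of_real pi * \<i> * w)) = x * w" for x
      by (simp add: field_simps)
    ultimately show "1 / (2 * of_real pi * \<i>) * (h (circlepath 0 1 s) / (circlepath 0 1 s - of_real r)
        * vector_derivative (circlepath 0 1) (at s within {0..1})) = poisson_kernel r s *\<^sub>R g (exp (2 * pi * \<i> * s))"
      by (simp only: w_def[symmetric])
  qed
qed

text \<open>The kernel is nonnegative for \<open>r < 1\<close>, and the Poisson formula for the
  constant function 1 gives total mass one.\<close>

lemma poisson_measure:
  assumes r: "0 \<le> r" "r < 1"
  defines "N \<equiv> density lborel (\<lambda>s. ennreal (indicator {0..1} s * poisson_kernel r s))"
  shows "prob_space N"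
    and "g holomorphic_on UNIV \<Longrightarrow> (\<integral>s. g (exp (2 * pi * \<i> * s)) \<partial>N) = g (of_real r)"
proof -
  have ne: "exp (2 * pi * \<i> * s) - of_real r \<noteq> 0" for s :: real
  proof
    assume "exp (2 * pi * \<i> * s) - of_real r = 0"
    then have "norm (exp (2 * pi * \<i> * complex_of_real s)) = norm (complex_of_real r)" by simp
    then show False using r by simp
  qed
  have cP: "continuous_on A (poisson_kernel r)" for A
    unfolding poisson_kernel_def using ne by (intro continuous_intros) auto
  then have [measurable]: "poisson_kernel r \<in> borel_measurable borel"
    by (rule borel_measurable_continuous_onI)
  have P0: "0 \<le> poisson_kernel r s" for s
    using r by (auto simp: poisson_kernel_def power_le_one intro!: divide_nonneg_nonneg)
  \<comment> \<open>The integrand is continuous on a compact interval, so the gauge integral of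
    \<open>poisson_formula\<close> is a Lebesgue integral.\<close>
  have eq: "(LINT s:{0..1}|lborel. poisson_kernel r s *\<^sub>R g (exp (2 * pi * \<i> * s))) = g (of_real r)"
    if g: "g holomorphic_on UNIV" for g
  proof -
    have cg: "continuous_on A (\<lambda>s::real. g (exp (2 * pi * \<i> * s)))" for A
      by (rule continuous_on_compose2[OF holomorphic_on_imp_continuous_on[OF g]])
        (auto intro!: continuous_intros)
    have *: "set_integrable lborel {0..1} (\<lambda>s. poisson_kernel r s *\<^sub>R g (exp (2 * pi * \<i> * s)))"
      by (intro borel_integrable_atLeastAtMost' continuous_intros cP cg)
    show "(LINT s:{0..1}|lborel. poisson_kernel r s *\<^sub>R g (exp (2 * pi * \<i> * s))) = g (of_real r)"
      using set_borel_integral_eq_integral(2)[OF *] poisson_formula[OF g r] by (simp add: integral_unique)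
  qed
  show "(\<integral>s. g (exp (2 * pi * \<i> * s)) \<partial>N) = g (of_real r)" if g: "g holomorphic_on UNIV"
  proof -
    have [measurable]: "g \<in> borel_measurable borel"
      using holomorphic_on_imp_continuous_on[OF g] by (rule borel_measurable_continuous_onI)
    show ?thesis
      unfolding N_def using eq[OF g] P0
      by (subst integral_density) (auto simp: set_lebesgue_integral_def)
  qed
  have "(\<integral>\<^sup>+ s. ennreal (indicator {0..1} s * poisson_kernel r s) \<partial>lborel)
      = ennreal (\<integral>s. indicator {0..1} s * poisson_kernel r s \<partial>lborel)"
    using P0 borel_integrable_atLeastAtMost'[OF cP, of 0 1]
    by (intro nn_integral_eq_integral) (auto simp: set_integrable_def)
  also have "(\<integral>s. indicator {0..1} s * poisson_kernel r s \<partial>lborel) = 1"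
  proof -
    have "complex_of_real (\<integral>s. indicator {0..1} s * poisson_kernel r s \<partial>lborel)
        = (\<integral>s. complex_of_real (indicator {0..1} s * poisson_kernel r s) \<partial>lborel)"
      by (rule integral_complex_of_real[symmetric])
    also have "\<dots> = 1"
      using eq[of "\<lambda>_. 1"] by (simp add: set_lebesgue_integral_def scaleR_conv_of_real)
    finally show ?thesis by (simp only: of_real_eq_1_iff)
  qed
  finally show "prob_space N"
    unfolding N_def by (intro prob_spaceI) (simp add: emeasure_density)
qed

text \<open>For \<open>r < 1\<close> the dilation is a Poisson average of rotations of
  \<open>f\<close>, and each rotation has the same weighted integral as \<open>f\<close>. At
  \<open>r = 1\<close>, where the kernel degenerates, both sides agree.\<close>

lemma nn_integral_fock_dilation_le:
  assumes f: "f holomorphic_on UNIV" and q: "1 \<le> q" and r: "0 \<le> r" "r \<le> 1"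
  shows "(\<integral>\<^sup>+ z. ennreal (fock_weight \<alpha> (\<lambda>z. f (of_real r * z)) z powr q) \<partial>lborel)
    \<le> (\<integral>\<^sup>+ z. ennreal (fock_weight \<alpha> f z powr q) \<partial>lborel)"
proof (cases "r = 1")
  case False
  with r have r: "0 \<le> r" "r < 1" by auto
  define N where "N = density lborel (\<lambda>s. ennreal (indicator {0..1} s * poisson_kernel r s))"
  define \<phi> where "\<phi> s = exp (2 * pi * \<i> * complex_of_real s)" for s
  have cf: "continuous_on UNIV f"
    using f by (rule holomorphic_on_imp_continuous_on)
  have [measurable]: "f \<in> borel_measurable borel"
    using cf by (rule borel_measurable_continuous_onI)
  have [measurable]: "\<phi> \<in> borel_measurable borel"
    unfolding \<phi>_def by measurable
  have rot: "(\<integral>\<^sup>+ z. ennreal (fock_weight \<alpha> (\<lambda>z. f (\<phi> s * z)) z powr q) \<partial>lborel)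
      = (\<integral>\<^sup>+ z. ennreal (fock_weight \<alpha> f z powr q) \<partial>lborel)" for s
  proof -
    have "norm (\<phi> s) = 1"
      by (simp add: \<phi>_def)
    moreover from this have "fock_weight \<alpha> (\<lambda>z. f (\<phi> s * z)) z = fock_weight \<alpha> f (\<phi> s * z)" for z
      by (simp add: fock_weight_def norm_mult)
    moreover have m: "(\<lambda>z. ennreal (fock_weight \<alpha> f z powr q)) \<in> borel_measurable borel"
      unfolding fock_weight_def by measurable
    ultimately show ?thesis
      using nn_integral_complex_rotation[OF m, of "\<phi> s"] by simp
  qed
  \<comment> \<open>The Poisson formula is applied in the variable \<open>w\<close>, with
    \<open>z\<close> fixed.\<close>
  have "f (of_real r * z) = (\<integral>s. f (\<phi> s * z) \<partial>N)" for z
  proof -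
    have "(\<lambda>w. f (w * z)) holomorphic_on UNIV"
      using holomorphic_on_compose_gen[of "\<lambda>w. w * z" UNIV f UNIV] f
      by (simp add: o_def holomorphic_on_mult)
    from poisson_measure(2)[OF r this] show ?thesis
      by (simp add: N_def \<phi>_def)
  qed
  then have "(\<integral>\<^sup>+ z. ennreal (fock_weight \<alpha> (\<lambda>z. f (of_real r * z)) z powr q) \<partial>lborel)
      = (\<integral>\<^sup>+ z. ennreal (fock_weight \<alpha> (\<lambda>z. \<integral>s. f (\<phi> s * z) \<partial>N) z powr q) \<partial>lborel)"
    by simp
  also have "\<dots> \<le> (\<integral>\<^sup>+ z. ennreal (fock_weight \<alpha> f z powr q) \<partial>lborel)"
  proof (rule nn_integral_fock_average_le)
    show "prob_space N"
      unfolding N_def by (rule poisson_measure(1)[OF r])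
    show "\<phi> \<in> borel_measurable N"
      by (simp add: N_def)
    show "AE s in N. norm (\<phi> s) \<le> 1"
      by (simp add: \<phi>_def)
  qed (use cf q rot in auto)
  finally show ?thesis .
qed simp

section \<open>Gaussian integrals and the constant function 1\<close>

lemma integrable_exp_neg_square:
  fixes \<beta> :: real
  assumes "0 < \<beta>"
  shows "integrable lborel (\<lambda>x. exp (- \<beta> * x\<^sup>2))"
proof -
  \<comment> \<open>The standard deviation for which the exponent of the normal density is
    \<open>- \<beta> * x\<^sup>2\<close>.\<close>
  define \<sigma> where "\<sigma> = 1 / sqrt (2 * \<beta>)"
  have s2: "2 * \<sigma>\<^sup>2 = 1 / \<beta>"
    using assms by (simp add: \<sigma>_def power_divide)
  have "0 < \<sigma>"
    using assms by (simp add: \<sigma>_def)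
  then have "(\<lambda>x. exp (- \<beta> * x\<^sup>2)) = (\<lambda>x. sqrt (2 * pi * \<sigma>\<^sup>2) * normal_density 0 \<sigma> x)"
    unfolding normal_density_def using s2 by (auto simp: mult.commute)
  moreover have "integrable lborel (\<lambda>x. sqrt (2 * pi * \<sigma>\<^sup>2) * normal_density 0 \<sigma> x)"
    using \<open>0 < \<sigma>\<close> by (intro integrable_mult_right integrable_normal_density)
  ultimately show ?thesis by simp
qed

lemma fock_weight_one_powr:
  "fock_weight \<alpha> (\<lambda>_. 1) z powr q = exp (- (\<alpha> * q / 2) * (norm z)\<^sup>2)"
  by (simp add: fock_weight_def powr_def algebra_simps)

text \<open>The constant 1 is the extremal function. Finiteness holds because the Gaussian factors
  over the coordinates; positivity of the norm admits 1 to the quotients in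
  \<open>fock_opnorm\<close>.\<close>

lemma in_fock_one:
  assumes p: "1 \<le> p" and \<alpha>: "0 < \<alpha>"
  shows "in_fock p \<alpha> (\<lambda>_. 1)" and "fock_norm p \<alpha> (\<lambda>_. 1) > 0"
proof -
  have b: "fock_weight \<alpha> (\<lambda>_. 1) z \<le> 1" for z
    using \<alpha> by (simp add: fock_weight_def)
  have bd: "bounded (range (fock_weight \<alpha> (\<lambda>_. 1)))"
    using b by (intro boundedI[of _ 1]) (auto simp: fock_weight_nonneg)
  have fin: "(\<integral>\<^sup>+ z. ennreal (fock_weight \<alpha> (\<lambda>_. 1) z powr enn2real p) \<partial>lborel) < \<infinity>"
    and pos: "0 < \<alpha> * enn2real p / (2 * pi) * (\<integral> z. fock_weight \<alpha> (\<lambda>_. 1) z powr enn2real p \<partial>lborel)"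
    if "p \<noteq> \<infinity>"
  proof -
    have q: "1 \<le> enn2real p"
      using p that enn2real_mono[of 1 p] by (simp add: less_top)
    define \<beta> where "\<beta> = \<alpha> * enn2real p / 2"
    have \<beta>: "0 < \<beta>"
      using \<alpha> q by (simp add: \<beta>_def)
    define J where "J = (\<integral>x. exp (- \<beta> * x\<^sup>2) \<partial>lborel)"
    have J: "(\<integral>\<^sup>+ x. ennreal (exp (- \<beta> * x\<^sup>2)) \<partial>lborel) = ennreal J"
      unfolding J_def by (intro nn_integral_eq_integral integrable_exp_neg_square \<beta>) auto
    have e: "fock_weight \<alpha> (\<lambda>_. 1) z powr enn2real p = exp (- \<beta> * (norm z)\<^sup>2)" for z
      by (simp add: fock_weight_one_powr \<beta>_def)
    have "(\<integral>\<^sup>+ z. ennreal (exp (- \<beta> * (norm (z::complex))\<^sup>2)) \<partial>lborel)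
        = (\<integral>\<^sup>+ y. \<integral>\<^sup>+ x. ennreal (exp (- \<beta> * x\<^sup>2)) * ennreal (exp (- \<beta> * y\<^sup>2)) \<partial>lborel \<partial>lborel)"
      by (subst nn_integral_lborel_complex(1))
        (simp_all add: cmod_def exp_add[symmetric] algebra_simps flip: ennreal_mult)
    also have "\<dots> = ennreal J * ennreal J"
      using J by (simp add: nn_integral_multc nn_integral_cmult)
    finally have g: "(\<integral>\<^sup>+ z. ennreal (exp (- \<beta> * (norm (z::complex))\<^sup>2)) \<partial>lborel) < \<infinity>"
      by (simp add: ennreal_mult_less_top)
    then show "(\<integral>\<^sup>+ z. ennreal (fock_weight \<alpha> (\<lambda>_. 1) z powr enn2real p) \<partial>lborel) < \<infinity>"
      by (simp only: e)
    have int: "integrable lborel (\<lambda>z::complex. exp (- \<beta> * (norm z)\<^sup>2))"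
      using g by (intro integrableI_nonneg) auto
    have "0 < (\<integral> z. exp (- \<beta> * (norm (z::complex))\<^sup>2) \<partial>lborel)"
    proof -
      \<comment> \<open>A vanishing integral would make this strictly positive integrand zero almost
        everywhere, although the plane has nonzero measure.\<close>
      have "(\<integral> z. exp (- \<beta> * (norm (z::complex))\<^sup>2) \<partial>lborel) \<noteq> 0"
        by (subst integral_nonneg_eq_0_iff_AE[OF int]) (auto simp: AE_iff_null)
      moreover have "0 \<le> (\<integral> z. exp (- \<beta> * (norm (z::complex))\<^sup>2) \<partial>lborel)"
        by simp
      ultimately show ?thesis by linarith
    qed
    then show "0 < \<alpha> * enn2real p / (2 * pi) * (\<integral> z. fock_weight \<alpha> (\<lambda>_. 1) z powr enn2real p \<partial>lborel)"
      unfolding e using \<alpha> q by (intro mult_pos_pos divide_pos_pos) auto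
  qed
  show "in_fock p \<alpha> (\<lambda>_. 1)"
    using bd fin by (simp add: in_fock_def)
  have "fock_weight \<alpha> (\<lambda>_. 1) 0 \<le> (SUP z. fock_weight \<alpha> (\<lambda>_. 1) z)"
    using bd by (intro cSUP_upper bounded_imp_bdd_above) auto
  then have "0 < (SUP z. fock_weight \<alpha> (\<lambda>_. 1) z)"
    by (simp add: fock_weight_def)
  with pos show "fock_norm p \<alpha> (\<lambda>_. 1) > 0"
    by (auto simp: fock_norm_def)
qed

lemma fock_norm_nonneg:
  assumes "in_fock p \<alpha> f"
  shows "0 \<le> fock_norm p \<alpha> f"
proof (cases "p = \<infinity>")
  case True
  then have "bounded (range (fock_weight \<alpha> f))"
    using assms by (simp add: in_fock_def)
  then have "fock_weight \<alpha> f 0 \<le> (SUP z. fock_weight \<alpha> f z)"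
    by (intro cSUP_upper bounded_imp_bdd_above) auto
  with True fock_weight_nonneg[of \<alpha> f 0] show ?thesis
    by (simp add: fock_norm_def)
qed (simp add: fock_norm_def)

lemma norm_divide_of_real_le:
  assumes "1 \<le> t"
  shows "norm (z / complex_of_real t) \<le> norm z"
proof -
  have "norm z * 1 \<le> norm z * t"
    using assms by (intro mult_left_mono) auto
  with assms show ?thesis
    by (simp add: norm_divide divide_le_eq)
qed

subsection \<open>The Hausdorff operator\<close>

text \<open>The form in which the hypotheses on \<open>\<mu>\<close> are used: the supremum is
  attained at \<open>n = 0\<close>, so its finiteness means that \<open>1 / t\<close> is
  integrable.\<close>

locale dilation_measure =
  fixes \<mu> :: "real measure"
  assumes sets_borel [measurable_cong]: "sets \<mu> = sets borel"
    and AE_ge_1: "AE t in \<mu>. 1 \<le> t"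
    and integrable_inverse: "integrable \<mu> (\<lambda>t. 1 / t)"
begin

definition mass :: real where
  "mass = (\<integral>t. 1 / t \<partial>\<mu>)"

lemma mass_nonneg: "0 \<le> mass"
  unfolding mass_def using AE_ge_1 by (intro integral_nonneg_AE) (auto elim: eventually_mono)

text \<open>For \<open>t \<ge> 1\<close> the point \<open>z / t\<close> stays in the disc of radius
  \<open>norm z\<close>, where \<open>f\<close> is bounded, so a multiple of \<open>1 / t\<close>
  dominates.\<close>

lemma integrable_dilations:
  assumes "continuous_on UNIV f"
  shows "integrable \<mu> (\<lambda>t. complex_of_real (1 / t) * f (z / complex_of_real t))"
proof -
  obtain B where B: "\<And>w. norm w \<le> norm z \<Longrightarrow> norm (f w) \<le> B"
    using continuous_bounded_on_disc[OF assms] by blast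
  have [measurable]: "f \<in> borel_measurable borel"
    using assms by (rule borel_measurable_continuous_onI)
  show ?thesis
  proof (rule Bochner_Integration.integrable_bound)
    show "integrable \<mu> (\<lambda>t. B * (1 / t))"
      by (intro integrable_mult_right integrable_inverse)
    show "AE t in \<mu>. norm (complex_of_real (1 / t) * f (z / complex_of_real t)) \<le> norm (B * (1 / t))"
      using AE_ge_1
    proof eventually_elim
      case (elim t)
      have "norm (z / complex_of_real t) \<le> norm z"
        using elim by (simp add: norm_divide_of_real_le)
      then have "norm (f (z / complex_of_real t)) \<le> B"
        by (rule B)
      with elim show ?case
        by (auto simp: norm_mult norm_divide divide_right_mono intro: order_trans[OF _ abs_ge_self])
    qed
  qed measurable
qed

text \<open>The Taylor series of \<open>f\<close> at 0 is integrated term by term, which exhibits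
  the image as an everywhere convergent power series with coefficients \<open>C n\<close>.\<close>

lemma holomorphic_hausdorff_op:
  assumes f: "f holomorphic_on UNIV"
  shows "hausdorff_op \<mu> f holomorphic_on UNIV"
proof -
  define c where "c n = (deriv ^^ n) f 0 / fact n" for n
  have c: "(\<lambda>n. c n * w ^ n) sums f w" for w
    using holomorphic_power_series[of f 0 "norm w + 1" w] holomorphic_on_subset[OF f]
    by (simp add: c_def)
  define C where "C n = c n * (\<integral>t. complex_of_real (1 / t) * (1 / complex_of_real t) ^ n \<partial>\<mu>)" for n
  have "(\<lambda>n. C n * z ^ n) sums hausdorff_op \<mu> f z" for z
  proof -
    define g where "g n t = complex_of_real (1 / t) * (c n * (z / complex_of_real t) ^ n)" for n t
    have gC: "integral\<^sup>L \<mu> (g n) = C n * z ^ n" for n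
    proof -
      have "g n = (\<lambda>t. (c n * z ^ n) * (complex_of_real (1 / t) * (1 / complex_of_real t) ^ n))"
        by (simp add: g_def fun_eq_iff power_divide)
      then show ?thesis
        by (simp only: C_def integral_mult_right_zero mult_ac)
    qed
    have int: "integrable \<mu> (g n)" for n
      unfolding g_def by (rule integrable_dilations[of "\<lambda>w. c n * w ^ n"]) (intro continuous_intros)
    \<comment> \<open>Convergence at the larger radius \<open>norm w + 1\<close> gives absolute
      convergence at \<open>w\<close>.\<close>
    have sm: "summable (\<lambda>n. norm (c n * w ^ n))" for w
      by (rule powser_insidea[of c "of_real (norm w + 1)"]) (use c in \<open>auto simp: sums_iff\<close>)
    have "(\<lambda>n. integral\<^sup>L \<mu> (g n)) sums (\<integral>t. (\<Sum>n. g n t) \<partial>\<mu>)"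
    proof (rule sums_integral[OF int])
      show "AE t in \<mu>. summable (\<lambda>n. norm (g n t))"
        unfolding g_def norm_mult[of "complex_of_real (1 / _)"] by (intro AE_I2 summable_mult sm)
      \<comment> \<open>Replacing \<open>z / t\<close> by \<open>z\<close> only increases the
        modulus of each term, so the integrated norms are dominated by a summable series.\<close>
      have bnd: "(\<integral>t. norm (g n t) \<partial>\<mu>) \<le> mass * norm (c n * z ^ n)" for n
      proof -
        have "(\<integral>t. norm (g n t) \<partial>\<mu>) \<le> (\<integral>t. norm (c n * z ^ n) * (1 / t) \<partial>\<mu>)"
        proof (rule integral_mono_AE)
          show "AE t in \<mu>. norm (g n t) \<le> norm (c n * z ^ n) * (1 / t)"
            using AE_ge_1
          proof eventually_elim
            case (elim t)
            have "norm (z / complex_of_real t) \<le> norm z"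
              using elim by (simp add: norm_divide_of_real_le)
            then have "norm (c n) * norm (z / complex_of_real t) ^ n \<le> norm (c n) * norm z ^ n"
              by (intro mult_left_mono power_mono) auto
            then have "1 / t * (norm (c n) * norm (z / complex_of_real t) ^ n) \<le> 1 / t * (norm (c n) * norm z ^ n)"
              by (rule mult_left_mono) (use elim in simp)
            moreover have "norm (g n t) = 1 / t * (norm (c n) * norm (z / complex_of_real t) ^ n)"
              using elim by (simp add: g_def norm_mult norm_power norm_divide)
            ultimately show ?case
              by (simp add: norm_mult norm_power mult.commute)
          qed
        qed (intro integrable_norm int integrable_mult_right integrable_inverse)+
        also have "\<dots> = mass * norm (c n * z ^ n)"
          unfolding integral_mult_right_zero mass_def by (rule mult.commute)
        finally show ?thesis .
      qed
      show "summable (\<lambda>n. \<integral>t. norm (g n t) \<partial>\<mu>)"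
        by (rule summable_comparison_test'[OF summable_mult[OF sm[of z], of mass], of 0])
          (use bnd in auto)
    qed
    moreover have "(\<Sum>n. g n t) = complex_of_real (1 / t) * f (z / complex_of_real t)" for t
      unfolding g_def using c[of "z / complex_of_real t"]
      by (simp only: suminf_mult sums_iff)
    ultimately show ?thesis
      by (simp add: gC hausdorff_op_def)
  qed
  then have "hausdorff_op \<mu> f holomorphic_on ball 0 (norm w + 1)" for w
    by (intro power_series_holomorphic[where a = C]) simp
  then have "\<exists>T. open T \<and> w \<in> T \<and> hausdorff_op \<mu> f holomorphic_on T" for w :: complex
    by (intro exI[of _ "ball 0 (norm w + 1)"]) auto
  then show ?thesis
    by (metis UNIV_I analytic_imp_holomorphic analytic_on_def analytic_on_analytic_at analytic_at)
qed

text \<open>A pointwise bound along the ray from \<open>z\<close> towards 0; it settles the case of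
  zero mass and the case \<open>p = \<infinity>\<close>.\<close>

lemma norm_hausdorff_op_le:
  assumes f: "continuous_on UNIV f" and B: "\<And>t. 1 \<le> t \<Longrightarrow> norm (f (z / complex_of_real t)) \<le> B"
  shows "norm (hausdorff_op \<mu> f z) \<le> mass * B"
proof -
  have "norm (hausdorff_op \<mu> f z) \<le> (\<integral>t. norm (complex_of_real (1 / t) * f (z / complex_of_real t)) \<partial>\<mu>)"
    unfolding hausdorff_op_def by (rule integral_norm_bound)
  also have "\<dots> \<le> (\<integral>t. B * (1 / t) \<partial>\<mu>)"
  proof (rule integral_mono_AE)
    show "AE t in \<mu>. norm (complex_of_real (1 / t) * f (z / complex_of_real t)) \<le> B * (1 / t)"
      using AE_ge_1
      by eventually_elim (use B in \<open>auto simp: norm_mult norm_divide intro!: divide_right_mono\<close>)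
  qed (intro integrable_norm integrable_dilations f integrable_mult_right integrable_inverse)+
  also have "\<dots> = mass * B"
    unfolding integral_mult_right_zero mass_def by (rule mult.commute)
  finally show ?thesis .
qed

lemma hausdorff_op_one: "hausdorff_op \<mu> (\<lambda>_. 1) = (\<lambda>_. complex_of_real mass)"
proof -
  have "hausdorff_op \<mu> (\<lambda>_. 1) z = (\<integral>t. complex_of_real (1 / t) \<partial>\<mu>)" for z
    by (simp only: hausdorff_op_def mult_1_right)
  then show ?thesis
    by (intro ext) (simp only: integral_complex_of_real mass_def)
qed

lemma nn_integral_fock_hausdorff_le:
  assumes f: "f holomorphic_on UNIV" and q: "1 \<le> q"
  shows "(\<integral>\<^sup>+ z. ennreal (fock_weight \<alpha> (hausdorff_op \<mu> f) z powr q) \<partial>lborel)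
    \<le> ennreal (mass powr q) * (\<integral>\<^sup>+ z. ennreal (fock_weight \<alpha> f z powr q) \<partial>lborel)"
proof (cases "mass = 0")
  \<comment> \<open>Zero mass is treated apart because the normalisation below divides by
    \<open>mass\<close>; here the operator is zero.\<close>
  case True
  have cf: "continuous_on UNIV f"
    using f by (rule holomorphic_on_imp_continuous_on)
  have "hausdorff_op \<mu> f z = 0" for z
  proof -
    obtain B where B: "\<And>w. norm w \<le> norm z \<Longrightarrow> norm (f w) \<le> B"
      using continuous_bounded_on_disc[OF cf] by blast
    have "norm (hausdorff_op \<mu> f z) \<le> mass * B"
      by (intro norm_hausdorff_op_le cf B) (simp add: norm_divide_of_real_le)
    with True show ?thesis by simp
  qed
  then show ?thesis by (simp add: fock_weight_def)
next
  case False
  with mass_nonneg have m: "0 < mass" by simp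
  have cf: "continuous_on UNIV f"
    using f by (rule holomorphic_on_imp_continuous_on)
  have [measurable]: "f \<in> borel_measurable borel"
    using cf by (rule borel_measurable_continuous_onI)
  \<comment> \<open>\<open>\<mu>\<close> may be infinite, but this weighted version is a probability
    measure, and the operator is \<open>mass\<close> times an average \<open>F\<close> of
    dilations.\<close>
  define N where "N = density \<mu> (\<lambda>t. ennreal (1 / (mass * t)))"
  define F where "F z = (\<integral>t. f (complex_of_real (1 / t) * z) \<partial>N)" for z
  have AE0: "AE t in \<mu>. 0 \<le> 1 / (mass * t)"
    using AE_ge_1 by eventually_elim (use m in auto)
  have AEN: "AE t in N. 1 \<le> t"
    unfolding N_def by (subst AE_density) (use AE_ge_1 in \<open>auto elim: eventually_mono\<close>)
  have eq: "hausdorff_op \<mu> f z = complex_of_real mass * F z" for z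
  proof -
    have "F z = (\<integral>t. (1 / (mass * t)) *\<^sub>R f (complex_of_real (1 / t) * z) \<partial>\<mu>)"
      unfolding F_def N_def using AE0 by (intro integral_density) auto
    also have "\<dots> = (\<integral>t. complex_of_real (1 / mass) * (complex_of_real (1 / t) * f (z / complex_of_real t)) \<partial>\<mu>)"
      by (simp add: scaleR_conv_of_real)
    also have "\<dots> = complex_of_real (1 / mass) * hausdorff_op \<mu> f z"
      by (simp only: integral_mult_right_zero hausdorff_op_def)
    finally show ?thesis using m by simp
  qed
  have "(\<integral>\<^sup>+ z. ennreal (fock_weight \<alpha> (hausdorff_op \<mu> f) z powr q) \<partial>lborel)
      = (\<integral>\<^sup>+ z. ennreal (mass powr q) * ennreal (fock_weight \<alpha> F z powr q) \<partial>lborel)"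
    using m by (simp add: fock_weight_def eq norm_mult powr_mult mult.assoc flip: ennreal_mult)
  also have "\<dots> = ennreal (mass powr q) * (\<integral>\<^sup>+ z. ennreal (fock_weight \<alpha> F z powr q) \<partial>lborel)"
  proof (rule nn_integral_cmult)
    \<comment> \<open>Measurability of \<open>F\<close> is drawn from the continuity of the entire
      function \<open>hausdorff_op \<mu> f\<close>.\<close>
    have "F = (\<lambda>z. hausdorff_op \<mu> f z / complex_of_real mass)"
      using m by (simp add: eq fun_eq_iff)
    moreover have "continuous_on UNIV (hausdorff_op \<mu> f)"
      using f by (intro holomorphic_on_imp_continuous_on holomorphic_hausdorff_op)
    ultimately have "continuous_on UNIV F"
      using m by (auto intro!: continuous_intros)
    then have [measurable]: "F \<in> borel_measurable borel"
      by (rule borel_measurable_continuous_onI)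
    show "(\<lambda>z. ennreal (fock_weight \<alpha> F z powr q)) \<in> borel_measurable lborel"
      unfolding fock_weight_def by measurable
  qed
  also have "\<dots> \<le> ennreal (mass powr q) * (\<integral>\<^sup>+ z. ennreal (fock_weight \<alpha> f z powr q) \<partial>lborel)"
    unfolding F_def
  proof (intro mult_left_mono nn_integral_fock_average_le)
    have "emeasure N (space N) = (\<integral>\<^sup>+ t. ennreal (1 / (mass * t)) \<partial>\<mu>)"
      by (simp add: N_def emeasure_density cong: nn_integral_cong)
    also have "\<dots> = ennreal (\<integral>t. 1 / (mass * t) \<partial>\<mu>)"
      using integrable_mult_right[OF integrable_inverse, of "1 / mass"] AE0
      by (intro nn_integral_eq_integral) auto
    also have "(\<integral>t. 1 / (mass * t) \<partial>\<mu>) = (\<integral>t. 1 / mass * (1 / t) \<partial>\<mu>)"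
      by simp
    also have "\<dots> = 1"
      unfolding integral_mult_right_zero mass_def[symmetric] using m by simp
    finally show "prob_space N"
      by (intro prob_spaceI) simp
    show "(\<lambda>t. complex_of_real (1 / t)) \<in> borel_measurable N"
      unfolding N_def by measurable
    show "AE t in N. norm (complex_of_real (1 / t)) \<le> 1"
      using AEN by eventually_elim (simp add: norm_divide)
    show "AE t in N. (\<integral>\<^sup>+ z. ennreal (fock_weight \<alpha> (\<lambda>z. f (complex_of_real (1 / t) * z)) z powr q) \<partial>lborel)
        \<le> (\<integral>\<^sup>+ z. ennreal (fock_weight \<alpha> f z powr q) \<partial>lborel)"
      using AEN by eventually_elim (intro nn_integral_fock_dilation_le f q, auto)
  qed (use cf q in auto)
  finally show ?thesis .
qed

section \<open>Boundedness and the operator norm\<close>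

lemma hausdorff_op_in_fock_and_norm_le:
  assumes p: "1 \<le> p" and \<alpha>: "0 < \<alpha>" and f: "in_fock p \<alpha> f"
  shows "in_fock p \<alpha> (hausdorff_op \<mu> f) \<and>
    fock_norm p \<alpha> (hausdorff_op \<mu> f) \<le> mass * fock_norm p \<alpha> f"
proof -
  have hf: "f holomorphic_on UNIV"
    using f by (simp add: in_fock_def)
  have cf: "continuous_on UNIV f"
    using hf by (rule holomorphic_on_imp_continuous_on)
  have hH: "hausdorff_op \<mu> f holomorphic_on UNIV"
    using hf by (rule holomorphic_hausdorff_op)
  have cH: "continuous_on UNIV (hausdorff_op \<mu> f)"
    using hH by (rule holomorphic_on_imp_continuous_on)
  show ?thesis
  proof (cases "p = \<infinity>")
    case True
    define B where "B = (SUP z. fock_weight \<alpha> f z)"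
    have "bdd_above (range (fock_weight \<alpha> f))"
      using f True by (simp add: in_fock_def bounded_imp_bdd_above)
    then have B: "fock_weight \<alpha> f z \<le> B" for z
      unfolding B_def by (intro cSUP_upper) auto
    have B0: "0 \<le> B"
      using B[of 0] fock_weight_nonneg[of \<alpha> f 0] by linarith
    have H: "fock_weight \<alpha> (hausdorff_op \<mu> f) z \<le> mass * B" for z
    proof -
      \<comment> \<open>The growth bound for \<open>f\<close> increases with the modulus, so its
        value at \<open>z\<close> bounds \<open>f\<close> at every \<open>z / t\<close>.\<close>
      have "norm (hausdorff_op \<mu> f z) \<le> mass * (B * exp ((\<alpha> / 2) * (norm z)\<^sup>2))"
      proof (rule norm_hausdorff_op_le[OF cf])
        fix t :: real assume t: "1 \<le> t"
        let ?w = "z / complex_of_real t"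
        have "norm ?w \<le> norm z"
          using t by (simp add: norm_divide_of_real_le)
        then have e: "exp ((\<alpha> / 2) * (norm ?w)\<^sup>2) \<le> exp ((\<alpha> / 2) * (norm z)\<^sup>2)"
          using \<alpha> by (auto intro!: mult_left_mono power_mono)
        have "norm (f ?w) = fock_weight \<alpha> f ?w * exp ((\<alpha> / 2) * (norm ?w)\<^sup>2)"
          by (simp add: fock_weight_def mult.assoc flip: exp_add)
        also have "\<dots> \<le> B * exp ((\<alpha> / 2) * (norm z)\<^sup>2)"
          by (intro mult_mono B e B0) auto
        finally show "norm (f ?w) \<le> B * exp ((\<alpha> / 2) * (norm z)\<^sup>2)" .
      qed
      then have "fock_weight \<alpha> (hausdorff_op \<mu> f) z
          \<le> mass * (B * exp ((\<alpha> / 2) * (norm z)\<^sup>2)) * exp (- (\<alpha> / 2) * (norm z)\<^sup>2)"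
        unfolding fock_weight_def by (intro mult_right_mono) auto
      also have "\<dots> = mass * B"
        by (simp add: mult.assoc flip: exp_add)
      finally show ?thesis .
    qed
    have "bounded (range (fock_weight \<alpha> (hausdorff_op \<mu> f)))"
      using H by (intro boundedI[of _ "mass * B"]) (auto simp: fock_weight_nonneg)
    moreover have "(SUP z. fock_weight \<alpha> (hausdorff_op \<mu> f) z) \<le> mass * B"
      using H by (intro cSUP_least) auto
    ultimately show ?thesis
      using True hH by (simp add: in_fock_def fock_norm_def B_def)
  next
    case False
    define q where "q = enn2real p"
    have q: "1 \<le> q"
      using p False enn2real_mono[of 1 p] by (simp add: q_def less_top)
    have [measurable]: "f \<in> borel_measurable borel" "hausdorff_op \<mu> f \<in> borel_measurable borel"
      using cf cH by (auto intro: borel_measurable_continuous_onI)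
    define I where "I g = (\<integral>\<^sup>+ z. ennreal (fock_weight \<alpha> g z powr q) \<partial>lborel)" for g
    have If: "I f < \<infinity>"
      using f False by (simp add: in_fock_def I_def q_def)
    have le: "I (hausdorff_op \<mu> f) \<le> ennreal (mass powr q) * I f"
      unfolding I_def by (rule nn_integral_fock_hausdorff_le[OF hf q])
    \<comment> \<open>Since \<open>enn2real\<close> sends infinity to 0, it is monotone only below a
      finite bound; the same finiteness gives membership of the image.\<close>
    have fin: "ennreal (mass powr q) * I f < \<infinity>"
      using If by (simp add: ennreal_mult_less_top)
    have int: "(\<integral> z. fock_weight \<alpha> g z powr q \<partial>lborel) = enn2real (I g)"
      if [measurable]: "g \<in> borel_measurable borel" for g
      unfolding I_def by (rule integral_eq_nn_integral) (auto simp: fock_weight_def)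
    have nrm: "fock_norm p \<alpha> g = (\<alpha> * q / (2 * pi) * enn2real (I g)) powr (1 / q)"
      if "g \<in> borel_measurable borel" for g
      using False int[OF that] by (simp add: fock_norm_def q_def)
    have "enn2real (I (hausdorff_op \<mu> f)) \<le> mass powr q * enn2real (I f)"
      using enn2real_mono[OF le] fin by (simp add: enn2real_mult)
    then have "fock_norm p \<alpha> (hausdorff_op \<mu> f)
        \<le> (mass powr q * (\<alpha> * q / (2 * pi) * enn2real (I f))) powr (1 / q)"
      using \<alpha> q by (subst nrm) (auto intro!: powr_mono2 mult_left_mono divide_right_mono simp: mult.left_commute)
    also have "\<dots> = (mass powr q) powr (1 / q) * fock_norm p \<alpha> f"
      by (simp only: nrm[OF \<open>f \<in> borel_measurable borel\<close>] powr_mult)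
    also have "(mass powr q) powr (1 / q) = mass"
      using q mass_nonneg by (simp add: powr_powr)
    finally have "fock_norm p \<alpha> (hausdorff_op \<mu> f) \<le> mass * fock_norm p \<alpha> f" .
    moreover have "in_fock p \<alpha> (hausdorff_op \<mu> f)"
      using hH False le_less_trans[OF le fin] by (simp add: in_fock_def I_def q_def)
    ultimately show ?thesis by simp
  qed
qed

text \<open>The image of 1 is the constant \<open>mass\<close>, so this is homogeneity of the norm.
  For \<open>p = \<infinity>\<close> it suffices that the weight of 1 is largest at the origin, with
  value 1.\<close>

lemma fock_norm_hausdorff_op_one:
  assumes p: "1 \<le> p" and \<alpha>: "0 < \<alpha>"
  shows "mass * fock_norm p \<alpha> (\<lambda>_. 1) \<le> fock_norm p \<alpha> (hausdorff_op \<mu> (\<lambda>_. 1))"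
proof -
  have w: "fock_weight \<alpha> (hausdorff_op \<mu> (\<lambda>_. 1)) z = mass * fock_weight \<alpha> (\<lambda>_. 1) z" for z
    using mass_nonneg by (simp add: hausdorff_op_one fock_weight_def)
  show ?thesis
  proof (cases "p = \<infinity>")
    case True
    \<comment> \<open>Membership bounds the weight, without which the real \<open>SUP\<close> need
      not dominate its values.\<close>
    have H: "in_fock p \<alpha> (hausdorff_op \<mu> (\<lambda>_. 1))"
      using hausdorff_op_in_fock_and_norm_le[OF p \<alpha> in_fock_one(1)[OF p \<alpha>]] by simp
    have "(SUP z. fock_weight \<alpha> (\<lambda>_. 1) z) \<le> 1"
      using \<alpha> by (intro cSUP_least) (auto simp: fock_weight_def)
    then have "mass * fock_norm p \<alpha> (\<lambda>_. 1) \<le> mass * 1"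
      using True mass_nonneg by (intro mult_left_mono) (auto simp: fock_norm_def)
    also have "\<dots> = fock_weight \<alpha> (hausdorff_op \<mu> (\<lambda>_. 1)) 0"
      unfolding w by (simp add: fock_weight_def)
    also have "\<dots> \<le> (SUP z. fock_weight \<alpha> (hausdorff_op \<mu> (\<lambda>_. 1)) z)"
      using H True by (intro cSUP_upper bounded_imp_bdd_above) (auto simp: in_fock_def)
    finally show ?thesis
      using True by (simp add: fock_norm_def)
  next
    case False
    define q where "q = enn2real p"
    have q: "1 \<le> q"
      using p False enn2real_mono[of 1 p] by (simp add: q_def less_top)
    have "fock_norm p \<alpha> (hausdorff_op \<mu> (\<lambda>_. 1))
        = (mass powr q * (\<alpha> * q / (2 * pi) * (\<integral> z. fock_weight \<alpha> (\<lambda>_. 1) z powr q \<partial>lborel))) powr (1 / q)"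
      using False mass_nonneg
      by (simp add: fock_norm_def w powr_mult fock_weight_nonneg mult.left_commute flip: q_def)
    also have "\<dots> = (mass powr q) powr (1 / q) * fock_norm p \<alpha> (\<lambda>_. 1)"
      using False by (simp only: fock_norm_def powr_mult if_False q_def[symmetric])
    also have "(mass powr q) powr (1 / q) = mass"
      using q mass_nonneg by (simp add: powr_powr)
    finally show ?thesis by simp
  qed
qed

text \<open>The supremum is a maximum: \<open>mass\<close> bounds every quotient and is the quotient
  at the constant 1.\<close>

lemma fock_opnorm_hausdorff_op:
  assumes p: "1 \<le> p" and \<alpha>: "0 < \<alpha>"
  shows "fock_opnorm p \<alpha> (hausdorff_op \<mu>) = mass"
proof -
  let ?S = "{fock_norm p \<alpha> (hausdorff_op \<mu> f) / fock_norm p \<alpha> f | f. in_fock p \<alpha> f \<and> fock_norm p \<alpha> f \<noteq> 0}"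
  note one = in_fock_one[OF p \<alpha>]
  have upper: "x \<le> mass" if "x \<in> ?S" for x
    using that hausdorff_op_in_fock_and_norm_le[OF p \<alpha>] fock_norm_nonneg[of p \<alpha>]
    by (auto simp: divide_le_eq less_le)
  have "fock_norm p \<alpha> (hausdorff_op \<mu> (\<lambda>_. 1)) / fock_norm p \<alpha> (\<lambda>_. 1) = mass"
    using hausdorff_op_in_fock_and_norm_le[OF p \<alpha> one(1)] fock_norm_hausdorff_op_one[OF p \<alpha>] one(2)
    by (simp add: field_simps order_antisym)
  then have "mass \<in> ?S"
    using one by (metis (mono_tags, lifting) less_irrefl mem_Collect_eq)
  with upper have "Sup ?S = mass"
    by (intro cSup_eq_maximum) auto
  then show ?thesis
    by (simp add: fock_opnorm_def)
qed

end

theorem theorem1: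
  fixes p :: ennreal and \<alpha> :: real and \<mu> :: "real measure"
  assumes p: "1 \<le> p"
    and alpha: "\<alpha> > 0"
    and borel: "sets \<mu> = sets borel"
    and pos_support: "emeasure \<mu> {..0} = 0"
    and vanish: "emeasure \<mu> {0<..<1} = 0"
    and bnd: "(SUP n::nat. \<integral>\<^sup>+ t\<in>{1..}. ennreal (1 / t ^ (n + 1)) \<partial>\<mu>) < \<infinity>"
  shows "(\<forall>f z. in_fock p \<alpha> f \<longrightarrow>
            integrable \<mu> (\<lambda>t. complex_of_real (1 / t) * f (z / complex_of_real t)))
       \<and> (\<forall>f. in_fock p \<alpha> f \<longrightarrow> in_fock p \<alpha> (hausdorff_op \<mu> f))
       \<and> (\<exists>C. \<forall>f. in_fock p \<alpha> f \<longrightarrow>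
                 fock_norm p \<alpha> (hausdorff_op \<mu> f) \<le> C * fock_norm p \<alpha> f)
       \<and> (SUP n::nat. \<integral>\<^sup>+ t\<in>{1..}. ennreal (1 / t ^ (n + 1)) \<partial>\<mu>)
           = ennreal (fock_opnorm p \<alpha> (hausdorff_op \<mu>))"
proof -
  note [measurable_cong] = borel
  have ge1: "AE t in \<mu>. 1 \<le> t"
  proof (rule AE_I')
    show "{..0} \<union> {0<..<1} \<in> null_sets \<mu>"
      using pos_support vanish borel by (intro null_sets.Un) (auto simp: null_sets_def)
  qed auto
  \<comment> \<open>Powers of \<open>t \<ge> 1\<close> grow with the exponent, so the integral for
    \<open>n = 0\<close> is the largest.\<close>
  have "(SUP n::nat. \<integral>\<^sup>+ t\<in>{1..}. ennreal (1 / t ^ (n + 1)) \<partial>\<mu>) = (\<integral>\<^sup>+ t\<in>{1..}. ennreal (1 / t ^ (0 + 1)) \<partial>\<mu>)"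
  proof (rule antisym[OF SUP_least SUP_upper])
    fix n :: nat
    show "(\<integral>\<^sup>+ t\<in>{1..}. ennreal (1 / t ^ (n + 1)) \<partial>\<mu>) \<le> (\<integral>\<^sup>+ t\<in>{1..}. ennreal (1 / t ^ (0 + 1)) \<partial>\<mu>)"
    proof (intro nn_integral_mono)
      fix t :: real
      have "1 / t ^ (n + 1) \<le> 1 / t ^ (0 + 1)" if "1 \<le> t"
        using that by (intro divide_left_mono power_increasing) auto
      then show "ennreal (1 / t ^ (n + 1)) * indicator {1..} t \<le> ennreal (1 / t ^ (0 + 1)) * indicator {1..} t"
        by (auto simp: indicator_def intro: ennreal_leI)
    qed
  qed simp
  \<comment> \<open>The indicator of \<open>{1..}\<close> is 1 almost everywhere, so this is an
    integral over the whole line, as in \<open>mass\<close>.\<close>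
  also have "\<dots> = (\<integral>\<^sup>+ t. ennreal (1 / t) \<partial>\<mu>)"
    using ge1 by (intro nn_integral_cong_AE) (auto elim!: eventually_mono)
  finally have sup_eq: "(SUP n::nat. \<integral>\<^sup>+ t\<in>{1..}. ennreal (1 / t ^ (n + 1)) \<partial>\<mu>) = (\<integral>\<^sup>+ t. ennreal (1 / t) \<partial>\<mu>)" .
  have nonneg: "AE t in \<mu>. 0 \<le> 1 / t"
    using ge1 by eventually_elim simp
  have int: "integrable \<mu> (\<lambda>t. 1 / t)"
    using bnd nonneg unfolding sup_eq by (intro integrableI_nonneg) auto
  interpret dilation_measure \<mu>
    using borel ge1 int by unfold_locales
  have "(\<integral>\<^sup>+ t. ennreal (1 / t) \<partial>\<mu>) = ennreal mass"
    unfolding mass_def by (rule nn_integral_eq_integral[OF int nonneg])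
  then have "(SUP n::nat. \<integral>\<^sup>+ t\<in>{1..}. ennreal (1 / t ^ (n + 1)) \<partial>\<mu>)
      = ennreal (fock_opnorm p \<alpha> (hausdorff_op \<mu>))"
    using sup_eq fock_opnorm_hausdorff_op[OF p alpha] by simp
  moreover have "integrable \<mu> (\<lambda>t. complex_of_real (1 / t) * f (z / complex_of_real t))"
    if "in_fock p \<alpha> f" for f z
    using that by (intro integrable_dilations holomorphic_on_imp_continuous_on) (simp add: in_fock_def)
  ultimately show ?thesis
    using hausdorff_op_in_fock_and_norm_le[OF p alpha] by blast
qed

end
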